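(* For every $v \in H^1(\Omega;\mathcal{T})$, $$\|v\| \le C_P\|\nabla v\| + \varepsilon^{-1/2}\sqrt{1+C_P^2}\,\|[\![v]\!]\|_{\Gamma},$$ where $C_P$ is the Poincaré–Friedrichs constant and $\nabla v$ denotes the elementwise gradient.
   Context: Let $\Omega\subset\mathbb{R}^d$ be a bounded polyhedral domain with $\partial\Omega=\overline{\Gamma}_D\cup\overline{\Gamma}_N$, where $\Gamma_D,\Gamma_N$ are disjoint relatively open subsets of $\partial\Omega$ and $\Gamma_D$ has positive surface measure. Let $\varepsilon>0$. Let $\mathcal{T}$ be a triangulation of $\Omega$ into open elements $K$, with $\boldsymbol n_K$ the outward unit normal on $\partial K$, and let $\Gamma$ be the mesh skeleton (union of all element faces/edges). $\|\cdot\|$ denotes the broken $L^2$ norm $\|w\|^2=\sum_{K\in\mathcal{T}}\int_K|w|^2\,dx$ (scalar or vector valued). $H^1(\Omega;\mathcal{T})=\{v: v|_K\in H^1(K)\ \forall K\in\mathcal{T}\}$, with gradients taken elementwise. $H^1_D(\Omega)=\{w\in H^1(\Omega): w=0 \text{ on }\Gamma_D\}$, $H_N(\mathrm{div},\Omega)=\{\boldsymbol w\in H(\mathrm{div},\Omega): \boldsymbol w\cdot\boldsymbol n=0\text{ on }\Gamma_N\}$ (traces). $\varepsilon$-scaled norm: $\|\boldsymbol w\|_{H_\varepsilon(\mathrm{div})}:=\big(\varepsilon^{-1}\|\boldsymbol w\|^2+\varepsilon^{-1}\|\nabla\cdot\boldsymbol w\|^2\big)^{1/2}$. Jump norm: for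 $v\in H^1(\Omega;\mathcal{T})$, $$\|[\![v]\!]\|_\Gamma:=\sup_{0\neq \boldsymbol w\in H_N(\mathrm{div},\Omega)}\frac{\sum_{K\in\mathcal{T}}\langle \boldsymbol w\cdot\boldsymbol n_K, v\rangle_{\partial K}}{\|\boldsymbol w\|_{H_\varepsilon(\mathrm{div})}},$$ where $\langle\cdot,\cdot\rangle_{\partial K}$ is the duality pairing on $\partial K$ (the boundary integral $\int_{\partial K}\boldsymbol w\cdot\boldsymbol n_K\, v\,ds$ for smooth functions). $C_P>0$ is the Poincaré–Friedrichs constant: $\|w\|\le C_P\|\nabla w\|$ for all $w\in H^1_D(\Omega)$. *)

theory Defs
  imports "HOL-Analysis.Analysis"
begin

definition grad :: "('a::euclidean_space \<Rightarrow> real) \<Rightarrow> 'a \<Rightarrow> 'a" where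
  "grad \<phi> x = (\<Sum>i\<in>Basis. frechet_derivative \<phi> (at x) i *\<^sub>R i)"

definition tsupp :: "('a::euclidean_space \<Rightarrow> real) \<Rightarrow> 'a set" where
  "tsupp \<phi> = closure {x. \<phi> x \<noteq> 0}"

definition C1c :: "('a::euclidean_space \<Rightarrow> real) \<Rightarrow> bool" where
  "C1c \<phi> \<longleftrightarrow> (\<forall>x. \<phi> differentiable (at x)) \<and> continuous_on UNIV (grad \<phi>) \<and> compact (tsupp \<phi>)"

definition test_fun :: "'a::euclidean_space set \<Rightarrow> ('a \<Rightarrow> real) \<Rightarrow> bool" where
  "test_fun U \<phi> \<longleftrightarrow> C1c \<phi> \<and> tsupp \<phi> \<subseteq> U"

definition L2_on :: "'a::euclidean_space set \<Rightarrow> ('a \<Rightarrow> 'b::euclidean_space) \<Rightarrow> bool" where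
  "L2_on U f \<longleftrightarrow> f \<in> borel_measurable (lebesgue_on U) \<and>
     integrable (lebesgue_on U) (\<lambda>x. (norm (f x))\<^sup>2)"

definition L2norm :: "'a::euclidean_space set \<Rightarrow> ('a \<Rightarrow> 'b::euclidean_space) \<Rightarrow> real" where
  "L2norm U f = sqrt (\<integral>x. (norm (f x))\<^sup>2 \<partial>lebesgue_on U)"

definition weak_grad :: "'a::euclidean_space set \<Rightarrow> ('a \<Rightarrow> real) \<Rightarrow> ('a \<Rightarrow> 'a) \<Rightarrow> bool" where
  "weak_grad U v g \<longleftrightarrow> L2_on U g \<and>
     (\<forall>\<phi>. test_fun U \<phi> \<longrightarrow>
        (\<integral>x. v x *\<^sub>R grad \<phi> x \<partial>lebesgue_on U) = - (\<integral>x. \<phi> x *\<^sub>R g x \<partial>lebesgue_on U))"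

definition weak_div :: "'a::euclidean_space set \<Rightarrow> ('a \<Rightarrow> 'a) \<Rightarrow> ('a \<Rightarrow> real) \<Rightarrow> bool" where
  "weak_div U w q \<longleftrightarrow> L2_on U q \<and>
     (\<forall>\<phi>. test_fun U \<phi> \<longrightarrow>
        (\<integral>x. w x \<bullet> grad \<phi> x \<partial>lebesgue_on U) = - (\<integral>x. \<phi> x * q x \<partial>lebesgue_on U))"

definition H1 :: "'a::euclidean_space set \<Rightarrow> ('a \<Rightarrow> real) \<Rightarrow> bool" where
  "H1 U v \<longleftrightarrow> L2_on U v \<and> (\<exists>g. weak_grad U v g)"

definition H1D :: "'a::euclidean_space set \<Rightarrow> 'a set \<Rightarrow> ('a \<Rightarrow> real) \<Rightarrow> bool" where
  "H1D \<Omega> \<Gamma>D w \<longleftrightarrow> H1 \<Omega> w \<and>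
     (\<exists>\<phi> :: nat \<Rightarrow> 'a \<Rightarrow> real. \<exists>g. weak_grad \<Omega> w g \<and>
        (\<forall>n. C1c (\<phi> n) \<and> tsupp (\<phi> n) \<inter> closure \<Gamma>D = {}) \<and>
        (\<lambda>n. L2norm \<Omega> (\<lambda>x. \<phi> n x - w x)) \<longlonglongrightarrow> 0 \<and>
        (\<lambda>n. L2norm \<Omega> (\<lambda>x. grad (\<phi> n) x - g x)) \<longlonglongrightarrow> 0)"

text \<open>H(div,Omega) with w.n = 0 on Gamma_N (normal trace defined by Green's formula,
  tested with C^1 functions whose support avoids closure Gamma_D); q is the divergence.\<close>
definition HNdiv :: "'a::euclidean_space set \<Rightarrow> 'a set \<Rightarrow> ('a \<Rightarrow> 'a) \<Rightarrow> ('a \<Rightarrow> real) \<Rightarrow> bool" where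
  "HNdiv \<Omega> \<Gamma>D w q \<longleftrightarrow> L2_on \<Omega> w \<and> weak_div \<Omega> w q \<and>
     (\<forall>\<phi>. C1c \<phi> \<and> tsupp \<phi> \<inter> closure \<Gamma>D = {} \<longrightarrow>
        (\<integral>x. w x \<bullet> grad \<phi> x + q x * \<phi> x \<partial>lebesgue_on \<Omega>) = 0)"

definition triangulation :: "'a::euclidean_space set \<Rightarrow> 'a set set \<Rightarrow> bool" where
  "triangulation \<Omega> \<T> \<longleftrightarrow> finite \<T> \<and>
     (\<forall>K\<in>\<T>. \<exists>S. int DIM('a) simplex S \<and> K = interior S) \<and>
     (\<forall>K\<in>\<T>. \<forall>K'\<in>\<T>. K \<noteq> K' \<longrightarrow> K \<inter> K' = {}) \<and>
     (\<forall>K\<in>\<T>. \<forall>K'\<in>\<T>. closure K \<inter> closure K' face_of closure K \<and>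
                       closure K \<inter> closure K' face_of closure K') \<and>
     \<Omega> = interior (\<Union>K\<in>\<T>. closure K) \<and> closure \<Omega> = (\<Union>K\<in>\<T>. closure K)"

definition bnorm :: "'a::euclidean_space set set \<Rightarrow> ('a \<Rightarrow> 'b::euclidean_space) \<Rightarrow> real" where
  "bnorm \<T> f = sqrt (\<Sum>K\<in>\<T>. \<integral>x. (norm (f x))\<^sup>2 \<partial>lebesgue_on K)"

text \<open>Duality pairing <w.n_K, v>_{dK}, defined by Green's formula on K,
  with q = div w and g = grad v on K.\<close>
definition bdry_pair :: "'a::euclidean_space set \<Rightarrow> ('a \<Rightarrow> 'a) \<Rightarrow> ('a \<Rightarrow> real) \<Rightarrow> ('a \<Rightarrow> real) \<Rightarrow> ('a \<Rightarrow> 'a) \<Rightarrow> real" where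
  "bdry_pair K w q v g = (\<integral>x. w x \<bullet> g x + q x * v x \<partial>lebesgue_on K)"

definition Hdiv_eps_norm :: "real \<Rightarrow> 'a::euclidean_space set set \<Rightarrow> ('a \<Rightarrow> 'a) \<Rightarrow> ('a \<Rightarrow> real) \<Rightarrow> real" where
  "Hdiv_eps_norm \<epsilon> \<T> w q = sqrt ((bnorm \<T> w)\<^sup>2 / \<epsilon> + (bnorm \<T> q)\<^sup>2 / \<epsilon>)"

definition jump_norm :: "real \<Rightarrow> 'a::euclidean_space set \<Rightarrow> 'a set \<Rightarrow> 'a set set \<Rightarrow> ('a \<Rightarrow> real) \<Rightarrow> ('a \<Rightarrow> 'a) \<Rightarrow> real" where
  "jump_norm \<epsilon> \<Omega> \<Gamma>D \<T> v g = Sup {(\<Sum>K\<in>\<T>. bdry_pair K w q v g) / Hdiv_eps_norm \<epsilon> \<T> w q | w q.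
      HNdiv \<Omega> \<Gamma>D w q \<and> Hdiv_eps_norm \<epsilon> \<T> w q \<noteq> 0}"

end

theory Submission
  imports Defs
begin

text \<open>Let \<open>w\<close> be the gradient of the solution of the mixed problem with \<open>div w = v\<close>,
  \<open>w \<cdot> n = 0\<close> on \<open>\<Gamma>N\<close> and vanishing potential on \<open>\<Gamma>D\<close>; the Poincare inequality gives
  \<open>\<parallel>w\<parallel> \<le> CP \<parallel>v\<parallel>\<close>. Elementwise integration by parts turns \<open>\<parallel>v\<parallel>\<^sup>2 = \<integral> v div w\<close> into
  \<open>- \<integral> w \<cdot> grad v\<close> plus the jump pairing of \<open>w\<close> with \<open>v\<close>, and the \<open>\<epsilon>\<close>-scaled norm of \<open>w\<close> is at most
  \<open>sqrt ((1 + CP\<^sup>2) / \<epsilon>) \<parallel>v\<parallel>\<close>.\<close>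

subsection \<open>The space \<open>L\<^sup>2\<close>\<close>

text \<open>No potential is ever constructed. \<open>HNdiv\<close> tests a field only against C^1
  functions supported away from \<open>closure \<Gamma>D\<close>, so it suffices that
  \<open>w\<close> represent a linear functional on the gradients of those functions. These
  gradients need not form a closed subspace, and functions are not identified almost everywhere, so
  \<open>L2norm\<close> is only a seminorm; the representer is therefore obtained by minimizing over
  the subspace itself. The functional sending \<open>grad \<phi>\<close> to
  \<open>- \<integral> f \<phi>\<close> is bounded because the Poincare inequality applies to each
  such \<open>\<phi>\<close>, which is how \<open>CP\<close> enters the bound on \<open>w\<close>
  with no further constant. Traces on faces do not occur either. \<open>bdry_pair\<close> is the
  Green defect of a single element, so summing it over the mesh only requires that the elements fill
  \<open>\<Omega>\<close> up to a null set. The final estimate has a factor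
  \<open>L2norm \<Omega> v\<close> on both sides. Cancelling it forces a separate case for norm
  zero, and replacing the scaled norm of \<open>w\<close> by its upper bound requires the jump norm
  to be nonnegative, which a real \<open>Sup\<close> does not give for free.\<close>

definition L2inner :: "'a::euclidean_space set \<Rightarrow> ('a \<Rightarrow> 'b::euclidean_space) \<Rightarrow> ('a \<Rightarrow> 'b) \<Rightarrow> real" where
  "L2inner U f g = (\<integral>x. f x \<bullet> g x \<partial>lebesgue_on U)"

lemma L2_on_measurable: "L2_on U f \<Longrightarrow> f \<in> borel_measurable (lebesgue_on U)"
  by (simp add: L2_on_def)

lemma L2_on_integrable_inner:
  assumes "L2_on U f" "L2_on U g"
  shows "integrable (lebesgue_on U) (\<lambda>x. f x \<bullet> g x)"
proof (rule Bochner_Integration.integrable_bound)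
  show "integrable (lebesgue_on U) (\<lambda>x. (norm (f x))\<^sup>2 + (norm (g x))\<^sup>2)"
    using assms by (auto simp: L2_on_def)
  show "(\<lambda>x. f x \<bullet> g x) \<in> borel_measurable (lebesgue_on U)"
    using assms by (auto simp: L2_on_def)
  have "\<bar>f x \<bullet> g x\<bar> \<le> (norm (f x))\<^sup>2 + (norm (g x))\<^sup>2" for x
  proof -
    have "\<bar>f x \<bullet> g x\<bar> \<le> norm (f x) * norm (g x)"
      by (rule Cauchy_Schwarz_ineq2)
    also have "\<dots> \<le> 2 * norm (f x) * norm (g x)"
      by simp
    also have "\<dots> \<le> (norm (f x))\<^sup>2 + (norm (g x))\<^sup>2"
      by (rule sum_squares_bound)
    finally show ?thesis .
  qed
  then show "AE x in lebesgue_on U. norm (f x \<bullet> g x) \<le> norm ((norm (f x))\<^sup>2 + (norm (g x))\<^sup>2)"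
    by simp
qed

lemma L2_on_scaleR: "L2_on U f \<Longrightarrow> L2_on U (\<lambda>x. c *\<^sub>R f x)"
  by (auto simp: L2_on_def power_mult_distrib)

lemma L2_on_add:
  assumes "L2_on U f" "L2_on U g"
  shows "L2_on U (\<lambda>x. f x + g x)"
proof -
  have "(norm (f x + g x))\<^sup>2 = (norm (f x))\<^sup>2 + 2 * (f x \<bullet> g x) + (norm (g x))\<^sup>2" for x
    by (simp add: power2_norm_eq_inner inner_simps inner_commute)
  then show ?thesis
    using assms L2_on_integrable_inner[OF assms] by (auto simp: L2_on_def)
qed

lemma L2_on_diff:
  assumes "L2_on U f" "L2_on U g"
  shows "L2_on U (\<lambda>x. f x - g x)"
  using L2_on_add[OF assms(1) L2_on_scaleR[OF assms(2), of "-1"]] by simp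

lemma L2inner_commute: "L2inner U f g = L2inner U g f"
  by (simp add: L2inner_def inner_commute)

lemma L2inner_add_left:
  assumes "L2_on U f" "L2_on U g" "L2_on U h"
  shows "L2inner U (\<lambda>x. f x + g x) h = L2inner U f h + L2inner U g h"
  using assms by (simp add: L2inner_def inner_simps L2_on_integrable_inner)

lemma L2inner_scaleR_left: "L2inner U (\<lambda>x. c *\<^sub>R f x) h = c * L2inner U f h"
  by (simp add: L2inner_def)

lemma L2inner_diff_left:
  assumes "L2_on U f" "L2_on U g" "L2_on U h"
  shows "L2inner U (\<lambda>x. f x - g x) h = L2inner U f h - L2inner U g h"
  using assms by (simp add: L2inner_def inner_simps L2_on_integrable_inner)

lemma L2norm_nonneg: "0 \<le> L2norm U f"
  by (simp add: L2norm_def)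

lemma L2norm_power2: "(L2norm U f)\<^sup>2 = (\<integral>x. (norm (f x))\<^sup>2 \<partial>lebesgue_on U)"
  by (simp add: L2norm_def)

lemma L2norm_power2_eq_L2inner: "(L2norm U f)\<^sup>2 = L2inner U f f"
  by (simp add: L2norm_power2 L2inner_def power2_norm_eq_inner)

lemma L2norm_scaleR: "L2norm U (\<lambda>x. c *\<^sub>R f x) = \<bar>c\<bar> * L2norm U f"
  by (simp add: L2norm_def power_mult_distrib real_sqrt_mult)

lemma L2norm_power2_add:
  assumes "L2_on U f" "L2_on U g"
  shows "(L2norm U (\<lambda>x. f x + t *\<^sub>R g x))\<^sup>2 = (L2norm U f)\<^sup>2 + 2 * t * L2inner U f g + t\<^sup>2 * (L2norm U g)\<^sup>2"
proof -
  have *: "(norm (f x + t *\<^sub>R g x))\<^sup>2 = (norm (f x))\<^sup>2 + 2 * t * (f x \<bullet> g x) + t\<^sup>2 * (norm (g x))\<^sup>2" for x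
    by (simp only: power2_norm_eq_inner inner_simps inner_commute[of "g x" "f x"]) (simp add: algebra_simps power2_eq_square)
  show ?thesis
    unfolding L2norm_power2 * L2inner_def
    using assms L2_on_integrable_inner[OF assms] by (simp add: L2_on_def)
qed

text \<open>First-order condition at a minimum: near \<open>t = 0\<close> the linear term dominates.
  The witness \<open>t = - d / (N + 1)\<close> is almost the minimizer of the quadratic; the added 1
  keeps the denominator positive when \<open>N = 0\<close>.\<close>

lemma real_linear_quadratic_nonneg_imp_zero:
  fixes d N :: real
  assumes "\<And>t. 0 \<le> t * d + t\<^sup>2 * N" and "0 \<le> N"
  shows "d = 0"
proof (rule ccontr)
  assume "d \<noteq> 0"
  have "0 \<le> (- d / (N + 1)) * d + (- d / (N + 1))\<^sup>2 * N"
    by (rule assms)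
  also have "\<dots> = - (d\<^sup>2 / (N + 1)\<^sup>2)"
  proof -
    have "N + 1 \<noteq> 0" using \<open>0 \<le> N\<close> by simp
    then show ?thesis by (simp add: divide_simps power2_eq_square) (simp add: algebra_simps)
  qed
  also have "\<dots> < 0"
    using \<open>d \<noteq> 0\<close> \<open>0 \<le> N\<close> by (simp add: zero_less_divide_iff)
  finally show False by simp
qed

lemma L2_Cauchy_Schwarz:
  assumes f: "L2_on U f" and g: "L2_on U g"
  shows "\<bar>L2inner U f g\<bar> \<le> L2norm U f * L2norm U g"
proof -
  have nonneg: "0 \<le> (L2norm U f)\<^sup>2 + 2 * t * L2inner U f g + t\<^sup>2 * (L2norm U g)\<^sup>2" for t
    unfolding L2norm_power2_add[OF f g, symmetric] by simp
  have "(L2inner U f g)\<^sup>2 \<le> (L2norm U f * L2norm U g)\<^sup>2"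
  proof (cases "L2norm U g = 0")
    case True
    have "L2inner U f g = 0"
    proof (rule ccontr)
      \<comment> \<open>With the quadratic coefficient zero the expression is affine in
        \<open>t\<close>; the chosen \<open>t\<close> gives it the value -1.\<close>
      assume "L2inner U f g \<noteq> 0"
      then show False
        using nonneg[of "- ((L2norm U f)\<^sup>2 + 1) / (2 * L2inner U f g)"] True by (simp add: field_simps)
    qed
    then show ?thesis by simp
  next
    case False
    \<comment> \<open>The value of \<open>t\<close> is the minimizer of the quadratic, where
      nonnegativity is the claim divided by \<open>(L2norm U g)\<^sup>2\<close>.\<close>
    then show ?thesis
      using nonneg[of "- L2inner U f g / (L2norm U g)\<^sup>2"] L2norm_nonneg[of U g]
      by (simp add: field_simps power2_eq_square zero_le_divide_iff mult_le_0_iff)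
  qed
  then show ?thesis
    by (metis abs_le_square_iff abs_of_nonneg L2norm_nonneg mult_nonneg_nonneg)
qed

section \<open>Sets of finite measure, completeness and representation of functionals\<close>

lemma L2_on_const:
  assumes "U \<in> lmeasurable"
  shows "L2_on U (\<lambda>x. c)"
proof -
  interpret finite_measure "lebesgue_on U"
    by (rule finite_measure_lebesgue_on[OF assms])
  show ?thesis by (simp add: L2_on_def)
qed

lemma L2_on_norm: "L2_on U f \<Longrightarrow> L2_on U (\<lambda>x. norm (f x))"
  using borel_measurable_norm by (auto simp: L2_on_def)

text \<open>Cauchy-Schwarz against the constant 1, which is square integrable because
  \<open>U\<close> has finite measure.\<close>

lemma L2_on_imp_integrable:
  assumes U: "U \<in> lmeasurable" and f: "L2_on U f"
  shows "integrable (lebesgue_on U) f"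
    and "(\<integral>x. norm (f x) \<partial>lebesgue_on U) \<le> L2norm U f * sqrt (measure lebesgue U)"
proof -
  have "integrable (lebesgue_on U) (\<lambda>x. norm (f x))"
    using L2_on_integrable_inner[OF L2_on_norm[OF f] L2_on_const[OF U, of 1]] by simp
  then show "integrable (lebesgue_on U) f"
    using L2_on_measurable[OF f] by (simp add: integrable_norm_iff)
  have "L2norm U (\<lambda>x. norm (f x)) = L2norm U f" "L2norm U (\<lambda>x. 1 :: real) = sqrt (measure lebesgue U)"
    using U by (simp_all add: L2norm_def measure_restrict_space fmeasurable_def)
  then show "(\<integral>x. norm (f x) \<partial>lebesgue_on U) \<le> L2norm U f * sqrt (measure lebesgue U)"
    using L2_Cauchy_Schwarz[OF L2_on_norm[OF f] L2_on_const[OF U, of 1]] by (simp add: L2inner_def)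
qed

text \<open>Riesz-Fischer theorem. Finite measure makes an L2-Cauchy sequence L1-Cauchy, which
  yields a subsequence converging almost everywhere; Fatou's lemma then upgrades the pointwise limit
  to an L2 limit of the whole sequence.\<close>

lemma L2_complete:
  fixes u :: "nat \<Rightarrow> 'a::euclidean_space \<Rightarrow> 'b::euclidean_space"
  assumes U: "U \<in> lmeasurable" and u: "\<And>n. L2_on U (u n)"
    and Cauchy: "\<And>e. e > 0 \<Longrightarrow> \<exists>N. \<forall>m\<ge>N. \<forall>n\<ge>N. L2norm U (\<lambda>x. u m x - u n x) < e"
  obtains G where "L2_on U G" "(\<lambda>n. L2norm U (\<lambda>x. u n x - G x)) \<longlonglongrightarrow> 0"
proof -
  let ?M = "lebesgue_on U"
  have ui: "integrable ?M (u n)" for n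
    by (rule L2_on_imp_integrable[OF U u])
  have [measurable]: "u n \<in> borel_measurable ?M" for n
    by (rule L2_on_measurable[OF u])
  have L1: "\<exists>N. \<forall>m\<ge>N. \<forall>n\<ge>N. (\<integral>x. norm (u m x - u n x) \<partial>?M) < e" if "e > 0" for e
  proof -
    \<comment> \<open>The added 1 allows division by \<open>?c\<close> even when \<open>U\<close> is
      a null set.\<close>
    let ?c = "sqrt (measure lebesgue U) + 1"
    have c: "?c > 0" by (smt (verit) real_sqrt_ge_zero measure_nonneg)
    obtain N where N: "\<And>m n. m \<ge> N \<Longrightarrow> n \<ge> N \<Longrightarrow> L2norm U (\<lambda>x. u m x - u n x) < e / ?c"
      using Cauchy[of "e / ?c"] c \<open>e > 0\<close> by force
    have "(\<integral>x. norm (u m x - u n x) \<partial>?M) < e" if "m \<ge> N" "n \<ge> N" for m n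
    proof -
      have "(\<integral>x. norm (u m x - u n x) \<partial>?M) \<le> L2norm U (\<lambda>x. u m x - u n x) * sqrt (measure lebesgue U)"
        by (intro L2_on_imp_integrable[OF U] L2_on_diff u)
      also have "\<dots> \<le> L2norm U (\<lambda>x. u m x - u n x) * ?c"
        by (intro mult_left_mono) (auto simp: L2norm_nonneg)
      also have "\<dots> < e"
        using N[OF that] c by (simp add: field_simps)
      finally show ?thesis .
    qed
    then show ?thesis by blast
  qed
  obtain r where r: "strict_mono r" and AE_Cauchy: "AE x in ?M. Cauchy (\<lambda>i. u (r i) x)"
    using cauchy_L1_AE_cauchy_subseq[of ?M u, OF ui L1] by blast
  define G where "G x = lim (\<lambda>i. u (r i) x)" for x
  have [measurable]: "G \<in> borel_measurable ?M"
    unfolding G_def by measurable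
  have conv: "AE x in ?M. (\<lambda>i. u (r i) x) \<longlonglongrightarrow> G x"
    using AE_Cauchy unfolding G_def
    by eventually_elim (simp add: Cauchy_convergent_iff convergent_LIMSEQ_iff)
  \<comment> \<open>Fatou with \<open>n\<close> fixed and the other index running along
    \<open>r\<close>. Nonnegative integrals are used because square integrability of
    \<open>u n - G\<close> is not yet known; it is deduced from this bound.\<close>
  have bound: "(\<integral>\<^sup>+x. ennreal ((norm (u n x - G x))\<^sup>2) \<partial>?M) \<le> ennreal (e\<^sup>2)"
    if N: "\<And>m. m \<ge> N \<Longrightarrow> L2norm U (\<lambda>x. u n x - u m x) < e" and "e > 0" for n N e
  proof -
    have "(\<integral>\<^sup>+x. ennreal ((norm (u n x - G x))\<^sup>2) \<partial>?M)
        = (\<integral>\<^sup>+x. liminf (\<lambda>i. ennreal ((norm (u n x - u (r i) x))\<^sup>2)) \<partial>?M)"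
    proof (rule nn_integral_cong_AE, use conv in eventually_elim)
      case (elim x)
      have "(\<lambda>i. ennreal ((norm (u n x - u (r i) x))\<^sup>2)) \<longlonglongrightarrow> ennreal ((norm (u n x - G x))\<^sup>2)"
        by (intro tendsto_intros elim)
      from lim_imp_Liminf[OF _ this] show ?case
        by simp
    qed
    also have "\<dots> \<le> liminf (\<lambda>i. \<integral>\<^sup>+x. ennreal ((norm (u n x - u (r i) x))\<^sup>2) \<partial>?M)"
      by (rule nn_integral_liminf) measurable
    also have "\<dots> \<le> ennreal (e\<^sup>2)"
    proof (rule Liminf_le)
      have "(\<integral>\<^sup>+x. ennreal ((norm (u n x - u (r i) x))\<^sup>2) \<partial>?M) \<le> ennreal (e\<^sup>2)" if "i \<ge> N" for i
      proof -
        have "r i \<ge> N" using that strict_mono_imp_increasing[OF r, of i] by simp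
        have "(\<integral>\<^sup>+x. ennreal ((norm (u n x - u (r i) x))\<^sup>2) \<partial>?M) = ennreal ((L2norm U (\<lambda>x. u n x - u (r i) x))\<^sup>2)"
          unfolding L2norm_power2 using L2_on_diff[OF u u, of n "r i"]
          by (intro nn_integral_eq_integral) (auto simp: L2_on_def)
        also have "\<dots> \<le> ennreal (e\<^sup>2)"
          using N[OF \<open>r i \<ge> N\<close>] L2norm_nonneg[of U "\<lambda>x. u n x - u (r i) x"]
          by (intro ennreal_leI power_mono) auto
        finally show ?thesis .
      qed
      then show "\<forall>\<^sub>F i in sequentially. (\<integral>\<^sup>+x. ennreal ((norm (u n x - u (r i) x))\<^sup>2) \<partial>?M) \<le> ennreal (e\<^sup>2)"
        by (auto simp: eventually_sequentially)
    qed auto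
    finally show ?thesis .
  qed
  have diff: "L2_on U (\<lambda>x. u n x - G x) \<and> L2norm U (\<lambda>x. u n x - G x) \<le> e"
    if N: "\<And>m. m \<ge> N \<Longrightarrow> L2norm U (\<lambda>x. u n x - u m x) < e" and "e > 0" for n N e
  proof -
    have le: "(\<integral>\<^sup>+x. ennreal ((norm (u n x - G x))\<^sup>2) \<partial>?M) \<le> ennreal (e\<^sup>2)"
      by (rule bound) (use N \<open>e > 0\<close> in auto)
    also have "\<dots> < \<infinity>" by simp
    finally have int: "integrable ?M (\<lambda>x. (norm (u n x - G x))\<^sup>2)"
      by (intro integrableI_bounded) simp_all
    then have "(\<integral>x. (norm (u n x - G x))\<^sup>2 \<partial>?M) \<le> e\<^sup>2"
      using le by (simp add: nn_integral_eq_integral)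
    then have "L2norm U (\<lambda>x. u n x - G x) \<le> e"
      using \<open>e > 0\<close> unfolding L2norm_def by (intro real_le_lsqrt) auto
    with int show ?thesis by (simp add: L2_on_def)
  qed
  obtain N where N: "\<And>m n. m \<ge> N \<Longrightarrow> n \<ge> N \<Longrightarrow> L2norm U (\<lambda>x. u m x - u n x) < 1"
    using Cauchy[of 1] by auto
  have "L2_on U (\<lambda>x. u N x - G x)"
    using diff[of N N 1] N by auto
  from L2_on_diff[OF u[of N] this] have "L2_on U G" by simp
  moreover have "(\<lambda>n. L2norm U (\<lambda>x. u n x - G x)) \<longlonglongrightarrow> 0"
  proof (rule LIMSEQ_I)
    fix e :: real assume "e > 0"
    then obtain N where N: "\<And>m n. m \<ge> N \<Longrightarrow> n \<ge> N \<Longrightarrow> L2norm U (\<lambda>x. u m x - u n x) < e / 2"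
      using Cauchy[of "e / 2"] by auto
    have "L2norm U (\<lambda>x. u n x - G x) \<le> e / 2" if "n \<ge> N" for n
      using diff[of N n "e / 2"] N that \<open>e > 0\<close> by auto
    then have "\<forall>n\<ge>N. L2norm U (\<lambda>x. u n x - G x) < e"
      using \<open>e > 0\<close> by force
    then show "\<exists>N. \<forall>n\<ge>N. norm (L2norm U (\<lambda>x. u n x - G x) - 0) < e"
      by (auto simp: L2norm_nonneg)
  qed
  ultimately show thesis by (rule that)
qed

lemma
  assumes p: "\<And>n. L2_on U (p n)" and G: "L2_on U G"
    and lim: "(\<lambda>n. L2norm U (\<lambda>x. p n x - G x)) \<longlonglongrightarrow> 0"
  shows L2inner_tendsto: "\<And>q. L2_on U q \<Longrightarrow> (\<lambda>n. L2inner U (p n) q) \<longlonglongrightarrow> L2inner U G q"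
    and L2norm_power2_tendsto: "(\<lambda>n. (L2norm U (p n))\<^sup>2) \<longlonglongrightarrow> (L2norm U G)\<^sup>2"
proof -
  show inner: "(\<lambda>n. L2inner U (p n) q) \<longlonglongrightarrow> L2inner U G q" if q: "L2_on U q" for q
  proof (rule LIM_zero_cancel, rule Lim_null_comparison)
    show "\<forall>\<^sub>F n in sequentially. norm (L2inner U (p n) q - L2inner U G q) \<le> L2norm U (\<lambda>x. p n x - G x) * L2norm U q"
      using L2_Cauchy_Schwarz[OF L2_on_diff[OF p G] q] by (simp add: L2inner_diff_left[OF p G q])
    show "(\<lambda>n. L2norm U (\<lambda>x. p n x - G x) * L2norm U q) \<longlonglongrightarrow> 0"
      using tendsto_mult_left_zero[OF lim] .
  qed
  \<comment> \<open>Expanding the square of \<open>p n - G\<close> reduces convergence of the norms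
    to convergence of the inner products with \<open>G\<close>.\<close>
  have "(L2norm U (p n))\<^sup>2 = (L2norm U (\<lambda>x. p n x - G x))\<^sup>2 + 2 * L2inner U (p n) G - (L2norm U G)\<^sup>2" for n
    using L2norm_power2_add[OF p G, of n "-1"] by simp
  moreover have "(\<lambda>n. (L2norm U (\<lambda>x. p n x - G x))\<^sup>2 + 2 * L2inner U (p n) G - (L2norm U G)\<^sup>2)
      \<longlonglongrightarrow> 0\<^sup>2 + 2 * L2inner U G G - (L2norm U G)\<^sup>2"
    by (intro tendsto_intros lim inner G)
  ultimately show "(\<lambda>n. (L2norm U (p n))\<^sup>2) \<longlonglongrightarrow> (L2norm U G)\<^sup>2"
    by (simp add: L2norm_power2_eq_L2inner)
qed

text \<open>\<open>S\<close> is the graph of a bounded linear functional on a subspace of \<open>L\<^sup>2\<close> that need not be closed;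
  the representing function is the limit of a minimizing sequence of
  \<open>(p, a) \<mapsto> \<parallel>p\<parallel>\<^sup>2 - 2 a\<close>, which is Cauchy by the parallelogram law.\<close>

lemma L2_Riesz_subspace:
  fixes S :: "(('a::euclidean_space \<Rightarrow> 'b::euclidean_space) \<times> real) set"
  assumes U: "U \<in> lmeasurable" and ne: "S \<noteq> {}"
    and L2: "\<And>p a. (p, a) \<in> S \<Longrightarrow> L2_on U p"
    and lin: "\<And>p a q b s t. (p, a) \<in> S \<Longrightarrow> (q, b) \<in> S \<Longrightarrow>
                (\<lambda>x. s *\<^sub>R p x + t *\<^sub>R q x, s * a + t * b) \<in> S"
    and bdd: "\<And>p a. (p, a) \<in> S \<Longrightarrow> \<bar>a\<bar> \<le> C * L2norm U p"
  obtains G where "L2_on U G" "L2norm U G \<le> \<bar>C\<bar>" "\<And>p a. (p, a) \<in> S \<Longrightarrow> L2inner U G p = a"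
proof -
  define J :: "('a \<Rightarrow> 'b) \<times> real \<Rightarrow> real"
    where "J = (\<lambda>(p, a). (L2norm U p)\<^sup>2 - 2 * a)"
  define I where "I = Inf (J ` S)"
  \<comment> \<open>Completing the square: \<open>a\<close> is at most
    \<open>C * L2norm U p\<close>, so \<open>J\<close> is at least
    \<open>(L2norm U p - C)\<^sup>2 - C\<^sup>2\<close>.\<close>
  have "J (p, a) \<ge> - C\<^sup>2" if "(p, a) \<in> S" for p a
  proof -
    have "0 \<le> (L2norm U p - C)\<^sup>2" by simp
    then show ?thesis
      using bdd[OF that] by (simp add: J_def power2_diff algebra_simps abs_le_iff)
  qed
  then have below: "bdd_below (J ` S)"
    by (auto intro!: bdd_belowI2[where m = "- C\<^sup>2"])
  have I_le: "I \<le> J z" if "z \<in> S" for z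
    unfolding I_def by (rule cINF_lower[OF below that])
  have "\<exists>z\<in>S. J z < I + 1 / real (Suc n)" for n
    using cINF_less_iff[OF ne below, of "I + 1 / real (Suc n)"] by (simp add: I_def)
  then obtain z where zS: "\<And>n. z n \<in> S" and zJ: "\<And>n. J (z n) < I + 1 / real (Suc n)"
    by metis
  define p where "p n = fst (z n)" for n
  define a where "a n = snd (z n)" for n
  have pS: "(p n, a n) \<in> S" for n
    using zS by (simp add: p_def a_def)
  have pL2: "L2_on U (p n)" for n
    by (rule L2[OF pS])
  have pJ: "(L2norm U (p n))\<^sup>2 - 2 * a n < I + 1 / real (Suc n)" for n
    using zJ[of n] by (simp add: J_def p_def a_def split_beta)
  have parallelogram: "(L2norm U (\<lambda>x. p m x - p n x))\<^sup>2 \<le> 2 / real (Suc m) + 2 / real (Suc n)" for m n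
  proof -
    \<comment> \<open>The midpoint of two members of \<open>S\<close> is again in \<open>S\<close>,
      so its \<open>J\<close>-value cannot fall below the infimum.\<close>
    have "I \<le> (L2norm U (\<lambda>x. (1/2) *\<^sub>R p m x + (1/2) *\<^sub>R p n x))\<^sup>2 - (a m + a n)"
      using I_le[OF lin[OF pS[of m] pS[of n], of "1/2" "1/2"]] by (simp add: J_def field_simps)
    also have "(L2norm U (\<lambda>x. (1/2) *\<^sub>R p m x + (1/2) *\<^sub>R p n x))\<^sup>2 = (L2norm U (\<lambda>x. p m x + 1 *\<^sub>R p n x))\<^sup>2 / 4"
      using L2norm_scaleR[of U "1/2" "\<lambda>x. p m x + p n x"]
      by (simp only: scaleR_right_distrib) (simp add: power_divide)
    finally have "4 * I + 4 * (a m + a n) \<le> (L2norm U (\<lambda>x. p m x + 1 *\<^sub>R p n x))\<^sup>2" by simp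
    moreover have "(L2norm U (\<lambda>x. p m x - p n x))\<^sup>2 = 2 * (L2norm U (p m))\<^sup>2 + 2 * (L2norm U (p n))\<^sup>2
        - (L2norm U (\<lambda>x. p m x + 1 *\<^sub>R p n x))\<^sup>2"
      using L2norm_power2_add[OF pL2 pL2, of m "-1" n] L2norm_power2_add[OF pL2 pL2, of m 1 n] by simp
    ultimately show ?thesis
      using pJ[of m] pJ[of n] by simp
  qed
  have "\<exists>N. \<forall>m\<ge>N. \<forall>n\<ge>N. L2norm U (\<lambda>x. p m x - p n x) < e" if "e > 0" for e
  proof -
    obtain N where N: "4 / e\<^sup>2 < real N" using reals_Archimedean2 by blast
    have "L2norm U (\<lambda>x. p m x - p n x) < e" if "m \<ge> N" "n \<ge> N" for m n
    proof -
      have "2 / real (Suc k) < e\<^sup>2 / 2" if "k \<ge> N" for k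
      proof -
        have "4 / e\<^sup>2 < real (Suc k)" using N that by simp
        then show ?thesis using \<open>e > 0\<close> by (simp add: field_simps)
      qed
      from this[OF \<open>m \<ge> N\<close>] this[OF \<open>n \<ge> N\<close>] have "(L2norm U (\<lambda>x. p m x - p n x))\<^sup>2 < e\<^sup>2"
        using parallelogram[of m n] by simp
      then show ?thesis using \<open>e > 0\<close> by (simp add: power2_less_imp_less)
    qed
    then show ?thesis by blast
  qed
  then obtain G where G: "L2_on U G" and lim: "(\<lambda>n. L2norm U (\<lambda>x. p n x - G x)) \<longlonglongrightarrow> 0"
    using L2_complete[OF U, of p] pL2 by blast
  have rep: "L2inner U G q = b" if q: "(q, b) \<in> S" for q b
  proof -
    \<comment> \<open>\<open>G\<close> need not be a member of \<open>S\<close>, so the variation in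
      direction \<open>q\<close> is made at \<open>p n\<close>. There the minimum property holds up
      to \<open>1 / real (Suc n)\<close>, an error that vanishes in the limit.\<close>
    have "0 \<le> t * (2 * (L2inner U G q - b)) + t\<^sup>2 * (L2norm U q)\<^sup>2" for t
    proof (rule LIMSEQ_le)
      show "(\<lambda>n. - (1 / real (Suc n))) \<longlonglongrightarrow> 0"
        using tendsto_minus[OF lim_inverse_n'[THEN LIMSEQ_Suc]] by simp
      show "(\<lambda>n. t * (2 * (L2inner U (p n) q - b)) + t\<^sup>2 * (L2norm U q)\<^sup>2)
          \<longlonglongrightarrow> t * (2 * (L2inner U G q - b)) + t\<^sup>2 * (L2norm U q)\<^sup>2"
        by (intro tendsto_intros L2inner_tendsto[OF pL2 G lim L2[OF q]])
      have "- (1 / real (Suc n)) \<le> t * (2 * (L2inner U (p n) q - b)) + t\<^sup>2 * (L2norm U q)\<^sup>2" for n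
        using I_le[OF lin[OF pS[of n] q, of 1 t]] pJ[of n] L2norm_power2_add[OF pL2 L2[OF q], of n t]
        by (simp add: J_def algebra_simps)
      then show "\<exists>N. \<forall>n\<ge>N. - (1 / real (Suc n)) \<le> t * (2 * (L2inner U (p n) q - b)) + t\<^sup>2 * (L2norm U q)\<^sup>2"
        by blast
    qed
    from real_linear_quadratic_nonneg_imp_zero[OF this] show ?thesis by simp
  qed
  have norm_lim: "(\<lambda>n. (L2norm U (p n))\<^sup>2) \<longlonglongrightarrow> (L2norm U G)\<^sup>2"
    by (rule L2norm_power2_tendsto[OF pL2 G lim])
  \<comment> \<open>Since \<open>p n\<close> tends to \<open>G\<close>, the square of the norm of
    \<open>G\<close> is the limit of \<open>L2inner U (p n) G\<close>, which equals
    \<open>a n\<close> by \<open>rep\<close> and so is controlled by the bound on the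
    functional.\<close>
  have "(L2norm U G)\<^sup>2 \<le> \<bar>C\<bar> * L2norm U G"
  proof (rule LIMSEQ_le)
    show "(\<lambda>n. L2inner U (p n) G) \<longlonglongrightarrow> (L2norm U G)\<^sup>2"
      using L2inner_tendsto[OF pL2 G lim G] by (simp add: L2norm_power2_eq_L2inner)
    show "(\<lambda>n. \<bar>C\<bar> * L2norm U (p n)) \<longlonglongrightarrow> \<bar>C\<bar> * L2norm U G"
      using tendsto_mult_left[OF tendsto_real_sqrt[OF norm_lim], of "\<bar>C\<bar>"] by (simp add: L2norm_nonneg)
    have "L2inner U (p n) G \<le> \<bar>C\<bar> * L2norm U (p n)" for n
    proof -
      have "L2inner U (p n) G = a n"
        using rep[OF pS] by (simp add: L2inner_commute)
      also have "\<dots> \<le> C * L2norm U (p n)"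
        using bdd[OF pS[of n]] by simp
      also have "\<dots> \<le> \<bar>C\<bar> * L2norm U (p n)"
        by (intro mult_right_mono) (auto simp: L2norm_nonneg)
      finally show ?thesis .
    qed
    then show "\<exists>N. \<forall>n\<ge>N. L2inner U (p n) G \<le> \<bar>C\<bar> * L2norm U (p n)" by blast
  qed
  then have "L2norm U G \<le> \<bar>C\<bar>"
    using L2norm_nonneg[of U G] by (cases "L2norm U G = 0") (auto simp: power2_eq_square)
  with G rep show thesis using that by blast
qed

subsection \<open>Compactly supported \<open>C\<^sup>1\<close> functions\<close>

lemma grad_inner:
  assumes "\<phi> differentiable (at x)"
  shows "grad \<phi> x \<bullet> h = frechet_derivative \<phi> (at x) h"
proof -
  interpret linear "frechet_derivative \<phi> (at x)"
    by (rule linear_frechet_derivative[OF assms])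
  have "frechet_derivative \<phi> (at x) h = frechet_derivative \<phi> (at x) (\<Sum>i\<in>Basis. (h \<bullet> i) *\<^sub>R i)"
    by (simp add: euclidean_representation)
  also have "\<dots> = grad \<phi> x \<bullet> h"
    by (simp add: sum scaleR grad_def inner_sum_left inner_sum_right inner_commute[of _ h] mult.commute)
  finally show ?thesis by simp
qed

lemma has_derivative_grad:
  assumes "\<phi> differentiable (at x)"
  shows "(\<phi> has_derivative (\<lambda>h. grad \<phi> x \<bullet> h)) (at x)"
  using assms by (simp add: grad_inner frechet_derivative_works)

lemma grad_eqI:
  assumes "(\<phi> has_derivative (\<lambda>h. d \<bullet> h)) (at x)"
  shows "grad \<phi> x = d"
  unfolding grad_def frechet_derivative_at[OF assms, symmetric] by (rule euclidean_representation)

lemma closed_tsupp [simp]: "closed (tsupp \<phi>)"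
  by (simp add: tsupp_def)

lemma not_in_tsuppD: "x \<notin> tsupp \<phi> \<Longrightarrow> \<phi> x = 0"
  using closure_subset[of "{x. \<phi> x \<noteq> 0}"] by (auto simp: tsupp_def)

text \<open>The complement of the closed support is open, so the function is zero in a whole
  neighbourhood of the point.\<close>

lemma grad_not_in_tsupp:
  assumes "x \<notin> tsupp \<phi>"
  shows "grad \<phi> x = 0"
proof (rule grad_eqI, rule has_derivative_transform_within_open)
  show "((\<lambda>_. 0) has_derivative (\<lambda>h. 0 \<bullet> h)) (at x)" by simp
  show "open (- tsupp \<phi>)" by (simp add: open_Compl)
qed (use assms not_in_tsuppD in fastforce)+

lemma tsupp_mono:
  assumes "\<And>x. \<phi> x \<noteq> 0 \<Longrightarrow> \<psi> x \<noteq> 0"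
  shows "tsupp \<phi> \<subseteq> tsupp \<psi>"
  unfolding tsupp_def by (intro closure_mono) (use assms in auto)

lemma tsupp_lincomb: "tsupp (\<lambda>x. s * \<phi> x + t * \<psi> x) \<subseteq> tsupp \<phi> \<union> tsupp \<psi>"
  unfolding tsupp_def closure_Un[symmetric] by (rule closure_mono) auto

lemma C1c_differentiable: "C1c \<phi> \<Longrightarrow> \<phi> differentiable (at x)"
  by (simp add: C1c_def)

lemma C1c_compact_tsupp: "C1c \<phi> \<Longrightarrow> compact (tsupp \<phi>)"
  by (simp add: C1c_def)

lemma C1c_continuous_grad: "C1c \<phi> \<Longrightarrow> continuous_on UNIV (grad \<phi>)"
  by (simp add: C1c_def)

lemma C1c_continuous: "C1c \<phi> \<Longrightarrow> continuous_on UNIV \<phi>"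
  by (simp add: C1c_def continuous_at_imp_continuous_on differentiable_imp_continuous_within)

lemma C1cI:
  assumes "\<And>x. (\<phi> has_derivative (\<lambda>h. d x \<bullet> h)) (at x)"
    and "continuous_on UNIV d" "compact K" "tsupp \<phi> \<subseteq> K"
  shows "C1c \<phi>" "grad \<phi> = d"
proof -
  show *: "grad \<phi> = d" using grad_eqI[OF assms(1)] by auto
  have "compact (K \<inter> tsupp \<phi>)"
    using \<open>compact K\<close> by (intro compact_Int_closed) auto
  then have "compact (tsupp \<phi>)"
    using \<open>tsupp \<phi> \<subseteq> K\<close> by (simp add: Int_absorb1)
  then show "C1c \<phi>"
    using assms unfolding C1c_def * by (auto simp: differentiable_def)
qed

lemma C1c_lincomb:
  assumes "C1c \<phi>" "C1c \<psi>"
  shows "C1c (\<lambda>x. s * \<phi> x + t * \<psi> x)"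
    and "grad (\<lambda>x. s * \<phi> x + t * \<psi> x) = (\<lambda>x. s *\<^sub>R grad \<phi> x + t *\<^sub>R grad \<psi> x)"
proof -
  have D: "((\<lambda>x. s * \<phi> x + t * \<psi> x) has_derivative (\<lambda>h. (s *\<^sub>R grad \<phi> x + t *\<^sub>R grad \<psi> x) \<bullet> h)) (at x)" for x
    by (rule derivative_eq_intros has_derivative_grad C1c_differentiable assms refl)+
       (simp add: inner_simps)
  have c: "continuous_on UNIV (\<lambda>x. s *\<^sub>R grad \<phi> x + t *\<^sub>R grad \<psi> x)"
    by (intro continuous_intros C1c_continuous_grad assms)
  have K: "compact (tsupp \<phi> \<union> tsupp \<psi>)"
    by (intro compact_Un C1c_compact_tsupp assms)
  show "C1c (\<lambda>x. s * \<phi> x + t * \<psi> x)"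
    "grad (\<lambda>x. s * \<phi> x + t * \<psi> x) = (\<lambda>x. s *\<^sub>R grad \<phi> x + t *\<^sub>R grad \<psi> x)"
    by (rule C1cI[OF D c K tsupp_lincomb])+
qed

lemma C1c_mult:
  assumes "C1c \<phi>" "C1c \<psi>"
  shows "C1c (\<lambda>x. \<phi> x * \<psi> x)"
    and "grad (\<lambda>x. \<phi> x * \<psi> x) = (\<lambda>x. \<phi> x *\<^sub>R grad \<psi> x + \<psi> x *\<^sub>R grad \<phi> x)"
proof -
  have D: "((\<lambda>x. \<phi> x * \<psi> x) has_derivative (\<lambda>h. (\<phi> x *\<^sub>R grad \<psi> x + \<psi> x *\<^sub>R grad \<phi> x) \<bullet> h)) (at x)" for x
    by (rule derivative_eq_intros has_derivative_grad C1c_differentiable assms refl)+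
       (simp add: inner_simps mult.commute)
  have c: "continuous_on UNIV (\<lambda>x. \<phi> x *\<^sub>R grad \<psi> x + \<psi> x *\<^sub>R grad \<phi> x)"
    by (intro continuous_intros C1c_continuous_grad C1c_continuous assms)
  have K: "compact (tsupp \<phi>)"
    by (intro C1c_compact_tsupp assms)
  have sub: "tsupp (\<lambda>x. \<phi> x * \<psi> x) \<subseteq> tsupp \<phi>"
    by (rule tsupp_mono) simp
  show "C1c (\<lambda>x. \<phi> x * \<psi> x)" "grad (\<lambda>x. \<phi> x * \<psi> x) = (\<lambda>x. \<phi> x *\<^sub>R grad \<psi> x + \<psi> x *\<^sub>R grad \<phi> x)"
    by (rule C1cI[OF D c K sub])+
qed

lemma C1c_zero: "C1c (\<lambda>x. 0)"
  by (rule C1cI(1)[of _ "\<lambda>_. 0" "{}"]) (auto simp: tsupp_def)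

section \<open>Integrability of compactly supported functions and integration by parts\<close>

lemma integrable_lborel_continuous_compact_support:
  fixes f :: "'a::euclidean_space \<Rightarrow> 'b::euclidean_space"
  assumes "continuous_on UNIV f" "compact K" "\<And>x. x \<notin> K \<Longrightarrow> f x = 0"
  shows "integrable lborel f"
proof -
  have "integrable lborel (\<lambda>x. indicator K x *\<^sub>R f x)"
    by (intro borel_integrable_compact continuous_on_subset[OF assms(1)] assms(2)) auto
  moreover have "(\<lambda>x. indicator K x *\<^sub>R f x) = f"
    using assms(3) by (auto simp: fun_eq_iff indicator_def)
  ultimately show ?thesis by simp
qed

lemma integrable_lebesgue_on_continuous_compact_support:
  fixes f :: "'a::euclidean_space \<Rightarrow> 'b::euclidean_space"
  assumes "continuous_on UNIV f" "compact K" "\<And>x. x \<notin> K \<Longrightarrow> f x = 0" "U \<in> sets lebesgue"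
  shows "integrable (lebesgue_on U) f"
proof -
  have "integrable lebesgue f"
    using integrable_lborel_continuous_compact_support[OF assms(1-3)] assms(1)
    by (simp add: integrable_completion borel_measurable_continuous_onI)
  then show ?thesis
    using assms(4) by (simp add: integrable_restrict_space integrable_mult_indicator)
qed

lemma L2_on_continuous_compact_support:
  fixes f :: "'a::euclidean_space \<Rightarrow> 'b::euclidean_space"
  assumes "continuous_on UNIV f" "compact K" "\<And>x. x \<notin> K \<Longrightarrow> f x = 0" "U \<in> sets lebesgue"
  shows "L2_on U f"
  unfolding L2_on_def
proof
  show "f \<in> borel_measurable (lebesgue_on U)"
    using integrable_lebesgue_on_continuous_compact_support[OF assms] by simp
  show "integrable (lebesgue_on U) (\<lambda>x. (norm (f x))\<^sup>2)"
    by (rule integrable_lebesgue_on_continuous_compact_support[of _ K])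
       (use assms in \<open>auto intro!: continuous_intros\<close>)
qed

lemma integral_lebesgue_on_support:
  fixes f :: "'a::euclidean_space \<Rightarrow> 'b::euclidean_space"
  assumes "U \<in> sets lebesgue" "\<And>x. x \<notin> U \<Longrightarrow> f x = 0"
  shows "integral\<^sup>L (lebesgue_on U) f = integral\<^sup>L lebesgue f"
proof -
  have "(\<lambda>x. indicator U x *\<^sub>R f x) = f"
    using assms(2) by (auto simp: fun_eq_iff indicator_def)
  then show ?thesis
    using assms(1) by (simp add: integral_restrict_space)
qed

lemma integral_lborel_translate:
  fixes f :: "'a::euclidean_space \<Rightarrow> 'b::euclidean_space"
  assumes "f \<in> borel_measurable borel"
  shows "(\<integral>x. f (x + c) \<partial>lborel) = (\<integral>x. f x \<partial>lborel)"
  using integral_distr[of "(+) c" lborel borel f] assms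
  by (simp add: lborel_distr_plus add.commute)

text \<open>Difference quotients have integral zero by translation invariance and converge
  boundedly to the directional derivative.\<close>

lemma integral_grad_eq_0:
  assumes \<psi>: "C1c \<psi>"
  shows "(\<integral>x. grad \<psi> x \<partial>lebesgue) = 0"
proof -
  have cont: "continuous_on UNIV \<psi>" and cgrad: "continuous_on UNIV (grad \<psi>)"
    by (rule C1c_continuous[OF \<psi>], rule C1c_continuous_grad[OF \<psi>])
  have K: "compact (tsupp \<psi>)" by (rule C1c_compact_tsupp[OF \<psi>])
  have [measurable]: "\<psi> \<in> borel_measurable borel" "grad \<psi> \<in> borel_measurable borel"
    by (intro borel_measurable_continuous_onI cont cgrad)+
  have int\<psi>: "integrable lborel \<psi>"
    by (rule integrable_lborel_continuous_compact_support[OF cont K]) (rule not_in_tsuppD)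
  have intgrad: "integrable lborel (grad \<psi>)"
    by (rule integrable_lborel_continuous_compact_support[OF cgrad K]) (rule grad_not_in_tsupp)
  obtain R where R: "\<And>x. x \<in> tsupp \<psi> \<Longrightarrow> norm x \<le> R"
    using compact_imp_bounded[OF K] by (auto simp: bounded_iff)
  have "bounded (grad \<psi> ` tsupp \<psi>)"
    by (intro compact_imp_bounded compact_continuous_image continuous_on_subset[OF cgrad] K) auto
  then obtain M where M: "\<And>x. x \<in> tsupp \<psi> \<Longrightarrow> norm (grad \<psi> x) \<le> M" and "M > 0"
    by (force simp: bounded_pos)
  have Mb: "norm (grad \<psi> x) \<le> M" for x
    using M[of x] grad_not_in_tsupp[of x \<psi>] \<open>M > 0\<close> by (cases "x \<in> tsupp \<psi>") auto
  \<comment> \<open>The mean value inequality bounds all difference quotients by \<open>M\<close>,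
    which supplies the dominating function below.\<close>
  have lip: "norm (\<psi> y - \<psi> x) \<le> M * norm (y - x)" for x y
  proof (rule differentiable_bound[of UNIV])
    show "(\<psi> has_derivative (\<lambda>h. grad \<psi> z \<bullet> h)) (at z within UNIV)" for z
      by (rule has_derivative_grad[OF C1c_differentiable[OF \<psi>]])
    show "onorm (\<lambda>h. grad \<psi> z \<bullet> h) \<le> M" for z
    proof (rule onorm_le)
      fix h
      show "norm (grad \<psi> z \<bullet> h) \<le> M * norm h"
        using Cauchy_Schwarz_ineq2[of "grad \<psi> z" h] mult_right_mono[OF Mb[of z], of "norm h"] by simp
    qed
  qed auto
  have "(\<integral>x. grad \<psi> x \<bullet> i \<partial>lborel) = 0" if i: "i \<in> Basis" for i
  proof -
    define t where "t n = 1 / real (Suc n)" for n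
    have t: "t n > 0" "t n \<le> 1" for n by (auto simp: t_def)
    define F where "F n x = (\<psi> (x + t n *\<^sub>R i) - \<psi> x) / t n" for n x
    have F0: "(\<integral>x. F n x \<partial>lborel) = 0" for n
    proof -
      have "integrable lborel (\<lambda>x. \<psi> (x + t n *\<^sub>R i))"
      proof (rule integrable_lborel_continuous_compact_support)
        show "continuous_on UNIV (\<lambda>x. \<psi> (x + t n *\<^sub>R i))"
          by (intro continuous_on_compose2[OF cont] continuous_intros) auto
        show "compact ((\<lambda>x. x - t n *\<^sub>R i) ` tsupp \<psi>)"
          by (intro compact_continuous_image K continuous_intros)
        show "\<psi> (x + t n *\<^sub>R i) = 0" if "x \<notin> (\<lambda>x. x - t n *\<^sub>R i) ` tsupp \<psi>" for x
          by (rule not_in_tsuppD) (use that in \<open>force simp: image_iff\<close>)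
      qed
      then show ?thesis
        using integral_lborel_translate[of \<psi> "t n *\<^sub>R i"] int\<psi> by (simp add: F_def)
    qed
    have "(\<lambda>n. \<integral>x. F n x \<partial>lborel) \<longlonglongrightarrow> (\<integral>x. grad \<psi> x \<bullet> i \<partial>lborel)"
    proof (rule integral_dominated_convergence)
      show "(\<lambda>x. grad \<psi> x \<bullet> i) \<in> borel_measurable lborel" "F n \<in> borel_measurable lborel" for n
        unfolding F_def by measurable
      \<comment> \<open>The support lies in the ball of radius \<open>R\<close> and the shifts
        \<open>t n\<close> are at most 1, so every quotient vanishes outside the ball of radius
        \<open>R + 1\<close>.\<close>
      show "integrable lborel (\<lambda>x. indicator (cball 0 (R + 1)) x *\<^sub>R M)"
        by (intro borel_integrable_compact) auto
      show "AE x in lborel. (\<lambda>n. F n x) \<longlonglongrightarrow> grad \<psi> x \<bullet> i"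
      proof (rule AE_I2)
        fix x
        have line: "((\<lambda>s. x + s *\<^sub>R i) has_derivative (\<lambda>s. s *\<^sub>R i)) (at 0)"
          by (auto intro!: derivative_eq_intros)
        have "((\<lambda>s. \<psi> (x + s *\<^sub>R i)) has_derivative (\<lambda>s. grad \<psi> x \<bullet> (s *\<^sub>R i))) (at 0)"
          using has_derivative_compose[OF line, of \<psi> "\<lambda>h. grad \<psi> x \<bullet> h"]
            has_derivative_grad[OF C1c_differentiable[OF \<psi>], of x] by simp
        then have "((\<lambda>s. \<psi> (x + s *\<^sub>R i)) has_field_derivative (grad \<psi> x \<bullet> i)) (at 0)"
          by (simp add: has_field_derivative_def mult_commute_abs)
        then have "(\<lambda>s. (\<psi> (x + s *\<^sub>R i) - \<psi> x) / s) \<midarrow>0\<rightarrow> grad \<psi> x \<bullet> i"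
          by (simp add: has_field_derivative_iff)
        moreover have "filterlim t (at 0) sequentially"
          using LIMSEQ_Suc[OF lim_inverse_n'] by (simp add: filterlim_at t_def[abs_def])
        ultimately show "(\<lambda>n. F n x) \<longlonglongrightarrow> grad \<psi> x \<bullet> i"
          unfolding F_def by (rule filterlim_compose[where g = "\<lambda>s. (\<psi> (x + s *\<^sub>R i) - \<psi> x) / s"])
      qed
      show "AE x in lborel. norm (F n x) \<le> indicator (cball 0 (R + 1)) x *\<^sub>R M" for n
      proof (rule AE_I2)
        fix x
        show "norm (F n x) \<le> indicator (cball 0 (R + 1)) x *\<^sub>R M"
        proof (cases "x \<in> cball 0 (R + 1)")
          case True
          have "\<bar>F n x\<bar> \<le> M"
            using lip[of "x + t n *\<^sub>R i" x] t[of n] i by (simp add: F_def field_simps)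
          with True show ?thesis by simp
        next
          case False
          have "norm x \<le> norm (x + t n *\<^sub>R i) + 1"
            using norm_triangle_ineq4[of "x + t n *\<^sub>R i" "t n *\<^sub>R i"] t[of n] i by simp
          with False R[of x] R[of "x + t n *\<^sub>R i"] have "x \<notin> tsupp \<psi>" "x + t n *\<^sub>R i \<notin> tsupp \<psi>"
            by force+
          then show ?thesis
            using \<open>M > 0\<close> by (simp add: F_def not_in_tsuppD)
        qed
      qed
    qed
    with F0 show ?thesis by (simp add: LIMSEQ_const_iff)
  qed
  then have "(\<integral>x. grad \<psi> x \<partial>lborel) = 0"
    using intgrad by (subst euclidean_eq_iff) simp
  then show ?thesis by (simp add: integral_completion)
qed

text \<open>The gradient of the product vanishes off \<open>U\<close> because \<open>\<eta>\<close>
  is supported in \<open>U\<close>. Its integral over \<open>U\<close> is therefore the integral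
  over the whole space, which is zero.\<close>

lemma integral_by_parts_C1c:
  assumes U: "U \<in> sets lebesgue" and \<phi>: "C1c \<phi>" and \<eta>: "test_fun U \<eta>"
  shows "(\<integral>x. \<phi> x *\<^sub>R grad \<eta> x \<partial>lebesgue_on U) = - (\<integral>x. \<eta> x *\<^sub>R grad \<phi> x \<partial>lebesgue_on U)"
proof -
  have \<eta>': "C1c \<eta>" and sub: "tsupp \<eta> \<subseteq> U" using \<eta> by (auto simp: test_fun_def)
  have i: "integrable (lebesgue_on U) (\<lambda>x. \<phi> x *\<^sub>R grad \<eta> x)" "integrable (lebesgue_on U) (\<lambda>x. \<eta> x *\<^sub>R grad \<phi> x)"
    by (rule integrable_lebesgue_on_continuous_compact_support[OF _ C1c_compact_tsupp[OF \<eta>'] _ U],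
        auto intro!: continuous_intros C1c_continuous C1c_continuous_grad \<phi> \<eta>' simp: grad_not_in_tsupp not_in_tsuppD)+
  have "(\<integral>x. grad (\<lambda>x. \<phi> x * \<eta> x) x \<partial>lebesgue_on U) = 0"
    unfolding integral_grad_eq_0[OF C1c_mult(1)[OF \<phi> \<eta>'], symmetric]
  proof (rule integral_lebesgue_on_support[OF U])
    fix x assume "x \<notin> U"
    with sub have "x \<notin> tsupp \<eta>" by auto
    then show "grad (\<lambda>x. \<phi> x * \<eta> x) x = 0"
      by (simp add: C1c_mult(2)[OF \<phi> \<eta>'] grad_not_in_tsupp not_in_tsuppD)
  qed
  then show ?thesis
    using i by (simp add: C1c_mult(2)[OF \<phi> \<eta>'] eq_neg_iff_add_eq_0)
qed

lemma L2_on_C1c: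
  assumes "U \<in> sets lebesgue" "C1c \<phi>"
  shows "L2_on U \<phi>" "L2_on U (grad \<phi>)"
proof -
  note L2 = L2_on_continuous_compact_support[OF _ C1c_compact_tsupp[OF assms(2)] _ assms(1)]
  show "L2_on U \<phi>"
    by (rule L2[OF C1c_continuous[OF assms(2)]]) (rule not_in_tsuppD)
  show "L2_on U (grad \<phi>)"
    by (rule L2[OF C1c_continuous_grad[OF assms(2)]]) (rule grad_not_in_tsupp)
qed

lemma weak_grad_C1c:
  assumes "U \<in> sets lebesgue" "C1c \<phi>"
  shows "weak_grad U \<phi> (grad \<phi>)"
  using assms by (simp add: weak_grad_def L2_on_C1c integral_by_parts_C1c)

text \<open>The constant sequence approximates \<open>\<phi>\<close>. This makes the Poincare
  inequality available for the smooth functions that test membership in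
  \<open>HNdiv\<close>.\<close>

lemma H1D_C1c:
  assumes "U \<in> sets lebesgue" "C1c \<phi>" "tsupp \<phi> \<inter> closure \<Gamma>D = {}"
  shows "H1D U \<Gamma>D \<phi>"
  unfolding H1D_def H1_def
  using assms weak_grad_C1c[OF assms(1,2)]
  by (auto simp: L2_on_C1c L2norm_def intro!: exI[of _ "\<lambda>_. \<phi>"] exI[of _ "grad \<phi>"])

subsection \<open>Fields with prescribed divergence\<close>

text \<open>\<open>w\<close> is the gradient of the solution of the mixed problem with right-hand side \<open>-f\<close>:
  it represents \<open>grad \<phi> \<mapsto> - \<integral> f \<phi>\<close> in the closure of the gradients of functions vanishing near
  \<open>\<Gamma>D\<close>.\<close>

lemma HNdiv_exists_div:
  fixes \<Omega> \<Gamma>D :: "'a::euclidean_space set"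
  assumes \<Omega>: "open \<Omega>" "bounded \<Omega>" and \<Gamma>D: "\<Gamma>D \<subseteq> frontier \<Omega>" and CP: "0 \<le> CP"
    and poincare: "\<And>w h. H1D \<Omega> \<Gamma>D w \<Longrightarrow> weak_grad \<Omega> w h \<Longrightarrow> L2norm \<Omega> w \<le> CP * L2norm \<Omega> h"
    and f: "L2_on \<Omega> f"
  obtains w where "HNdiv \<Omega> \<Gamma>D w f" "L2norm \<Omega> w \<le> CP * L2norm \<Omega> f"
proof -
  have meas: "\<Omega> \<in> lmeasurable" "\<Omega> \<in> sets lebesgue"
    using lmeasurable_open[OF \<Omega>(2,1)] by (auto simp: fmeasurable_def)
  \<comment> \<open>The second component depends on \<open>\<phi>\<close> itself rather than on its
    gradient. That it is controlled by the gradient is the content of \<open>bdd\<close>, where the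
    Poincare inequality enters.\<close>
  define S where "S = {(grad \<phi>, - L2inner \<Omega> f \<phi>) | \<phi>. C1c \<phi> \<and> tsupp \<phi> \<inter> closure \<Gamma>D = {}}"
  have ne: "S \<noteq> {}"
    using C1c_zero by (auto simp: S_def tsupp_def intro!: exI[of _ "\<lambda>_. 0"])
  have L2: "L2_on \<Omega> p" if "(p, a) \<in> S" for p a
    using that L2_on_C1c[OF meas(2)] by (auto simp: S_def)
  have lin: "(\<lambda>x. s *\<^sub>R p x + t *\<^sub>R q x, s * a + t * b) \<in> S" if "(p, a) \<in> S" "(q, b) \<in> S" for p a q b s t
  proof -
    obtain \<phi> \<psi> where \<phi>: "C1c \<phi>" "tsupp \<phi> \<inter> closure \<Gamma>D = {}" "p = grad \<phi>" "a = - L2inner \<Omega> f \<phi>"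
      and \<psi>: "C1c \<psi>" "tsupp \<psi> \<inter> closure \<Gamma>D = {}" "q = grad \<psi>" "b = - L2inner \<Omega> f \<psi>"
      using \<open>(p, a) \<in> S\<close> \<open>(q, b) \<in> S\<close> by (auto simp: S_def)
    have "L2inner \<Omega> f (\<lambda>x. s * \<phi> x + t * \<psi> x) = s * L2inner \<Omega> f \<phi> + t * L2inner \<Omega> f \<psi>"
      using L2inner_add_left[of \<Omega> "\<lambda>x. s *\<^sub>R \<phi> x" "\<lambda>x. t *\<^sub>R \<psi> x" f] f
        L2inner_scaleR_left[of \<Omega> s \<phi> f] L2inner_scaleR_left[of \<Omega> t \<psi> f]
        L2_on_scaleR[OF L2_on_C1c(1)[OF meas(2) \<phi>(1)], of s] L2_on_scaleR[OF L2_on_C1c(1)[OF meas(2) \<psi>(1)], of t]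
      by (simp add: L2inner_commute[of \<Omega> f])
    then show ?thesis
      using C1c_lincomb[OF \<phi>(1) \<psi>(1), of s t] tsupp_lincomb[of s \<phi> t \<psi>] \<phi> \<psi>
      unfolding S_def by (intro CollectI exI[of _ "\<lambda>x. s * \<phi> x + t * \<psi> x"]) auto
  qed
  have bdd: "\<bar>a\<bar> \<le> CP * L2norm \<Omega> f * L2norm \<Omega> p" if "(p, a) \<in> S" for p a
  proof -
    obtain \<phi> where \<phi>: "C1c \<phi>" "tsupp \<phi> \<inter> closure \<Gamma>D = {}" "p = grad \<phi>" "a = - L2inner \<Omega> f \<phi>"
      using \<open>(p, a) \<in> S\<close> by (auto simp: S_def)
    have "\<bar>a\<bar> \<le> L2norm \<Omega> f * L2norm \<Omega> \<phi>"
      using L2_Cauchy_Schwarz[OF f L2_on_C1c(1)[OF meas(2) \<phi>(1)]] \<phi>(4) by simp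
    also have "\<dots> \<le> L2norm \<Omega> f * (CP * L2norm \<Omega> p)"
      unfolding \<phi>(3) using poincare[OF H1D_C1c[OF meas(2) \<phi>(1,2)] weak_grad_C1c[OF meas(2) \<phi>(1)]]
      by (intro mult_left_mono) (auto simp: L2norm_nonneg)
    finally show ?thesis by (simp add: mult_ac)
  qed
  obtain w where w: "L2_on \<Omega> w" and wnorm: "L2norm \<Omega> w \<le> \<bar>CP * L2norm \<Omega> f\<bar>"
    and rep: "\<And>p a. (p, a) \<in> S \<Longrightarrow> L2inner \<Omega> w p = a"
    by (rule L2_Riesz_subspace[OF meas(1) ne, of "CP * L2norm \<Omega> f"])
       (erule L2 | erule (1) lin | erule bdd | blast)+
  have green: "(\<integral>x. w x \<bullet> grad \<phi> x \<partial>lebesgue_on \<Omega>) = - (\<integral>x. \<phi> x * f x \<partial>lebesgue_on \<Omega>)"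
    if "C1c \<phi>" "tsupp \<phi> \<inter> closure \<Gamma>D = {}" for \<phi>
  proof -
    have "(grad \<phi>, - L2inner \<Omega> f \<phi>) \<in> S"
      unfolding S_def using that by blast
    from rep[OF this] show ?thesis by (simp add: L2inner_def mult.commute)
  qed
  \<comment> \<open>\<open>closure \<Gamma>D\<close> stays in the frontier, which misses the open
    set \<open>\<Omega>\<close>. Hence interior test functions are admissible in
    \<open>green\<close>, and the weak divergence is a special case of it.\<close>
  have "closure \<Gamma>D \<inter> \<Omega> = {}"
    using closure_minimal[OF \<Gamma>D frontier_closed] frontier_disjoint_eq[of \<Omega>] \<Omega>(1) by auto
  then have "test_fun \<Omega> \<phi> \<Longrightarrow> C1c \<phi> \<and> tsupp \<phi> \<inter> closure \<Gamma>D = {}" for \<phi>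
    by (auto simp: test_fun_def)
  then have "weak_div \<Omega> w f"
    using f green by (auto simp: weak_div_def)
  moreover have "(\<integral>x. w x \<bullet> grad \<phi> x + f x * \<phi> x \<partial>lebesgue_on \<Omega>) = 0"
    if \<phi>: "C1c \<phi>" "tsupp \<phi> \<inter> closure \<Gamma>D = {}" for \<phi>
    using L2_on_integrable_inner[OF w L2_on_C1c(2)[OF meas(2) \<phi>(1)]]
      L2_on_integrable_inner[OF f L2_on_C1c(1)[OF meas(2) \<phi>(1)]] green[OF \<phi>]
    by (simp add: mult.commute)
  ultimately have "HNdiv \<Omega> \<Gamma>D w f"
    using w by (auto simp: HNdiv_def)
  with wnorm show thesis
    using that CP by (simp add: L2norm_nonneg)
qed

text \<open>Makes the set of admissible quotients in \<open>jump_norm\<close> symmetric under change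
  of sign, whence its supremum is nonnegative.\<close>

lemma HNdiv_uminus:
  assumes "HNdiv \<Omega> \<Gamma>D w q"
  shows "HNdiv \<Omega> \<Gamma>D (\<lambda>x. - w x) (\<lambda>x. - q x)"
proof -
  have "(\<integral>x. - (w x \<bullet> grad \<phi> x) - q x * \<phi> x \<partial>lebesgue_on \<Omega>)
      = - (\<integral>x. w x \<bullet> grad \<phi> x + q x * \<phi> x \<partial>lebesgue_on \<Omega>)" for \<phi>
    by (subst integral_minus[symmetric]) simp
  then show ?thesis
    using assms L2_on_scaleR[of \<Omega> w "-1"] L2_on_scaleR[of \<Omega> q "-1"]
    by (auto simp: HNdiv_def weak_div_def)
qed

subsection \<open>Integration over a mesh\<close>

text \<open>A point of \<open>\<Omega>\<close> outside every element lies in the closure of some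
  element, hence on its frontier. Elements are interiors of simplices, so convex, and convex sets
  have negligible frontier.\<close>

lemma triangulation_cover:
  fixes \<Omega> :: "'a::euclidean_space set"
  assumes "triangulation \<Omega> \<T>"
  shows "finite \<T>" "disjoint \<T>" "\<And>K. K \<in> \<T> \<Longrightarrow> open K \<and> K \<subseteq> \<Omega>" "negligible (\<Omega> - \<Union>\<T>)"
proof -
  show fin: "finite \<T>" and "disjoint \<T>"
    using assms by (auto simp: triangulation_def pairwise_def disjnt_def)
  have \<Omega>: "\<Omega> = interior (\<Union>K\<in>\<T>. closure K)"
    using assms by (simp add: triangulation_def)
  have conv: "open K \<and> convex K" if "K \<in> \<T>" for K
  proof -
    have "\<forall>K\<in>\<T>. \<exists>S. int DIM('a) simplex S \<and> K = interior S"
      using assms unfolding triangulation_def by (elim conjE)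
    with that obtain S where "int DIM('a) simplex S" "K = interior S"
      by blast
    then show ?thesis
      using convex_interior[OF convex_simplex] by auto
  qed
  show "open K \<and> K \<subseteq> \<Omega>" if "K \<in> \<T>" for K
  proof -
    have "K \<subseteq> (\<Union>K\<in>\<T>. closure K)"
      using that closure_subset[of K] by blast
    then show ?thesis
      unfolding \<Omega> using conv[OF that] by (simp add: interior_maximal)
  qed
  have "negligible (\<Union>K\<in>\<T>. frontier K)"
    using fin conv by (auto intro: negligible_convex_frontier)
  moreover have "\<Omega> - \<Union>\<T> \<subseteq> (\<Union>K\<in>\<T>. frontier K)"
  proof
    fix x assume "x \<in> \<Omega> - \<Union>\<T>"
    moreover have "\<Omega> \<subseteq> (\<Union>K\<in>\<T>. closure K)"
      unfolding \<Omega> by (rule interior_subset)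
    ultimately obtain K where "K \<in> \<T>" "x \<in> closure K" "x \<notin> K"
      by blast
    then show "x \<in> (\<Union>K\<in>\<T>. frontier K)"
      using conv by (auto simp: frontier_def interior_open)
  qed
  ultimately show "negligible (\<Omega> - \<Union>\<T>)"
    by (rule negligible_subset)
qed

text \<open>Off the null set a point of \<open>\<Omega>\<close> lies in exactly one element. Writing
  the restriction to \<open>\<Omega>\<close> as a finite sum lets measurability, integrability and
  the value of the integral pass from the elements to \<open>\<Omega>\<close> by linearity.\<close>

lemma negligible_partition_AE:
  assumes \<T>: "finite \<T>" "disjoint \<T>" and sub: "\<And>K. K \<in> \<T> \<Longrightarrow> K \<subseteq> \<Omega>"
    and null: "negligible (\<Omega> - \<Union>\<T>)"
  shows "AE x in lebesgue. (\<Sum>K\<in>\<T>. indicator K x *\<^sub>R f x) = indicator \<Omega> x *\<^sub>R (f x :: 'b::real_vector)"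
proof (rule AE_I')
  show "\<Omega> - \<Union>\<T> \<in> null_sets lebesgue"
    using null by (simp add: negligible_iff_null_sets)
  have "(\<Sum>K\<in>\<T>. indicator K x *\<^sub>R f x) = indicator \<Omega> x *\<^sub>R f x" if "x \<notin> \<Omega> - \<Union>\<T>" for x
  proof (cases "x \<in> \<Omega>")
    case True
    with that obtain K where K: "K \<in> \<T>" "x \<in> K" by blast
    have "(\<Sum>K'\<in>\<T>. indicator K' x *\<^sub>R f x) = (\<Sum>K'\<in>{K}. indicator K' x *\<^sub>R f x)"
      using \<T> K by (intro sum.mono_neutral_right) (auto simp: pairwise_def disjnt_def indicator_def)
    then show ?thesis using True K by simp
  next
    case False
    then have "x \<notin> K" if "K \<in> \<T>" for K using sub that by auto
    then show ?thesis using False by simp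
  qed
  then show "{x \<in> space lebesgue. (\<Sum>K\<in>\<T>. indicator K x *\<^sub>R f x) \<noteq> indicator \<Omega> x *\<^sub>R f x} \<subseteq> \<Omega> - \<Union>\<T>"
    by blast
qed

lemma measurable_negligible_partition:
  fixes f :: "'a::euclidean_space \<Rightarrow> 'b::euclidean_space"
  assumes \<T>: "finite \<T>" "disjoint \<T>" and sub: "\<And>K. K \<in> \<T> \<Longrightarrow> K \<subseteq> \<Omega>"
    and null: "negligible (\<Omega> - \<Union>\<T>)"
    and meas: "\<And>K. K \<in> \<T> \<Longrightarrow> K \<in> sets lebesgue" "\<Omega> \<in> sets lebesgue"
    and f: "\<And>K. K \<in> \<T> \<Longrightarrow> f \<in> borel_measurable (lebesgue_on K)"
  shows "f \<in> borel_measurable (lebesgue_on \<Omega>)"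
proof -
  have "(\<lambda>x. indicator K x *\<^sub>R f x) \<in> borel_measurable lebesgue" if "K \<in> \<T>" for K
    using f[OF that] meas(1)[OF that] by (simp add: borel_measurable_restrict_space_iff)
  then have "(\<lambda>x. \<Sum>K\<in>\<T>. indicator K x *\<^sub>R f x) \<in> borel_measurable lebesgue"
    by (intro borel_measurable_sum)
  from borel_measurable_AE[OF this negligible_partition_AE[OF \<T> sub null]] show ?thesis
    using meas(2) by (simp add: borel_measurable_restrict_space_iff)
qed

lemma integral_negligible_partition:
  fixes f :: "'a::euclidean_space \<Rightarrow> 'b::euclidean_space"
  assumes \<T>: "finite \<T>" "disjoint \<T>" and sub: "\<And>K. K \<in> \<T> \<Longrightarrow> K \<subseteq> \<Omega>"
    and null: "negligible (\<Omega> - \<Union>\<T>)"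
    and meas: "\<And>K. K \<in> \<T> \<Longrightarrow> K \<in> sets lebesgue" "\<Omega> \<in> sets lebesgue"
    and f: "\<And>K. K \<in> \<T> \<Longrightarrow> integrable (lebesgue_on K) f"
  shows "integrable (lebesgue_on \<Omega>) f"
    and "integral\<^sup>L (lebesgue_on \<Omega>) f = (\<Sum>K\<in>\<T>. integral\<^sup>L (lebesgue_on K) f)"
proof -
  note AE = negligible_partition_AE[OF \<T> sub null, of f]
  have int: "integrable lebesgue (\<lambda>x. indicator K x *\<^sub>R f x)" if "K \<in> \<T>" for K
    using f[OF that] meas(1)[OF that] by (simp add: integrable_restrict_space)
  then have sum: "integrable lebesgue (\<lambda>x. \<Sum>K\<in>\<T>. indicator K x *\<^sub>R f x)"
    by (intro Bochner_Integration.integrable_sum)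
  have "f \<in> borel_measurable (lebesgue_on \<Omega>)"
    by (rule measurable_negligible_partition[OF \<T> sub null meas borel_measurable_integrable[OF f]])
  then have meas\<Omega>: "(\<lambda>x. indicator \<Omega> x *\<^sub>R f x) \<in> borel_measurable lebesgue"
    using meas(2) by (simp add: borel_measurable_restrict_space_iff)
  show "integrable (lebesgue_on \<Omega>) f"
    using integrable_cong_AE_imp[OF sum meas\<Omega> AE] meas(2)
    by (simp add: integrable_restrict_space)
  have "integral\<^sup>L (lebesgue_on \<Omega>) f = (\<integral>x. (\<Sum>K\<in>\<T>. indicator K x *\<^sub>R f x) \<partial>lebesgue)"
    using integral_cong_AE[OF borel_measurable_integrable[OF sum] meas\<Omega> AE] meas(2)
    by (simp add: integral_restrict_space)
  also have "\<dots> = (\<Sum>K\<in>\<T>. integral\<^sup>L (lebesgue_on K) f)"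
    using int meas(1) by (simp add: Bochner_Integration.integral_sum integral_restrict_space)
  finally show "integral\<^sup>L (lebesgue_on \<Omega>) f = (\<Sum>K\<in>\<T>. integral\<^sup>L (lebesgue_on K) f)" .
qed

lemma integrable_lebesgue_on_subset:
  fixes f :: "'a::euclidean_space \<Rightarrow> 'b::euclidean_space"
  assumes "integrable (lebesgue_on \<Omega>) f" "K \<subseteq> \<Omega>" "K \<in> sets lebesgue" "\<Omega> \<in> sets lebesgue"
  shows "integrable (lebesgue_on K) f"
proof -
  have "integrable lebesgue (\<lambda>x. indicator \<Omega> x *\<^sub>R f x)"
    using assms(1,4) by (simp add: integrable_restrict_space)
  then have "integrable lebesgue (\<lambda>x. indicator K x *\<^sub>R (indicator \<Omega> x *\<^sub>R f x))"
    by (rule integrable_mult_indicator[OF assms(3)])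
  moreover have "(\<lambda>x. indicator K x *\<^sub>R (indicator \<Omega> x *\<^sub>R f x)) = (\<lambda>x. indicator K x *\<^sub>R f x)"
    using assms(2) by (auto simp: fun_eq_iff indicator_def)
  ultimately show ?thesis
    using assms(3) by (simp add: integrable_restrict_space)
qed

text \<open>The passage from mesh quantities to quantities on \<open>\<Omega>\<close>.
  \<open>sum_bdry_pair\<close> is the summed integration by parts: each pairing is already a volume
  integral, so only additivity over the mesh remains.\<close>

lemma
  fixes \<Omega> :: "'a::euclidean_space set"
  assumes tri: "triangulation \<Omega> \<T>"
  shows L2_on_triangulation: "(\<And>K. K \<in> \<T> \<Longrightarrow> L2_on K f) \<Longrightarrow> L2_on \<Omega> f"
    and bnorm_eq_L2norm: "L2_on \<Omega> f \<Longrightarrow> bnorm \<T> f = L2norm \<Omega> f"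
    and sum_bdry_pair: "L2_on \<Omega> w \<Longrightarrow> L2_on \<Omega> g \<Longrightarrow> L2_on \<Omega> q \<Longrightarrow> L2_on \<Omega> v \<Longrightarrow>
      (\<Sum>K\<in>\<T>. bdry_pair K w q v g) = L2inner \<Omega> w g + L2inner \<Omega> q v"
proof -
  note cover = triangulation_cover[OF tri]
  have "open \<Omega>" using tri by (metis triangulation_def open_interior)
  then have meas: "K \<in> \<T> \<Longrightarrow> K \<subseteq> \<Omega>" "K \<in> \<T> \<Longrightarrow> K \<in> sets lebesgue" "\<Omega> \<in> sets lebesgue" for K
    using cover(3) by auto
  note part = integral_negligible_partition[OF cover(1,2) meas(1) cover(4) meas(2,3)]
  show "L2_on \<Omega> f" if L2: "\<And>K. K \<in> \<T> \<Longrightarrow> L2_on K f"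
    unfolding L2_on_def
  proof
    show "f \<in> borel_measurable (lebesgue_on \<Omega>)"
      by (rule measurable_negligible_partition[OF cover(1,2) meas(1) cover(4) meas(2,3) L2_on_measurable[OF L2]])
    have int: "integrable (lebesgue_on K) (\<lambda>x. (norm (f x))\<^sup>2)" if "K \<in> \<T>" for K
      using L2[OF that] by (simp add: L2_on_def)
    show "integrable (lebesgue_on \<Omega>) (\<lambda>x. (norm (f x))\<^sup>2)"
      by (rule part(1)[OF _ _ int])
  qed
  have sum: "(\<Sum>K\<in>\<T>. integral\<^sup>L (lebesgue_on K) h) = integral\<^sup>L (lebesgue_on \<Omega>) h"
    if "integrable (lebesgue_on \<Omega>) h" for h :: "'a \<Rightarrow> real"
    using part(2)[of h] integrable_lebesgue_on_subset[OF that meas(1,2,3)] by simp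
  show "bnorm \<T> f = L2norm \<Omega> f" if "L2_on \<Omega> f"
    using that by (simp add: bnorm_def L2norm_def L2_on_def sum)
  show "(\<Sum>K\<in>\<T>. bdry_pair K w q v g) = L2inner \<Omega> w g + L2inner \<Omega> q v"
    if "L2_on \<Omega> w" "L2_on \<Omega> g" "L2_on \<Omega> q" "L2_on \<Omega> v"
    using L2_on_integrable_inner[OF that(1,2)] L2_on_integrable_inner[OF that(3,4)]
    by (simp add: bdry_pair_def sum L2inner_def)
qed

text \<open>The real \<open>Sup\<close> in \<^const>\<open>jump_norm\<close> is an upper bound only because its set is bounded, by Cauchy-Schwarz.\<close>

lemma jump_norm_upper:
  fixes \<Omega> :: "'a::euclidean_space set"
  assumes tri: "triangulation \<Omega> \<T>" and eps: "\<epsilon> > 0"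
    and v: "L2_on \<Omega> v" and g: "L2_on \<Omega> g"
    and w: "HNdiv \<Omega> \<Gamma>D w q" and nz: "Hdiv_eps_norm \<epsilon> \<T> w q \<noteq> 0"
  shows "(\<Sum>K\<in>\<T>. bdry_pair K w q v g) / Hdiv_eps_norm \<epsilon> \<T> w q \<le> jump_norm \<epsilon> \<Omega> \<Gamma>D \<T> v g"
  unfolding jump_norm_def
proof (rule cSup_upper)
  show "bdd_above {(\<Sum>K\<in>\<T>. bdry_pair K w q v g) / Hdiv_eps_norm \<epsilon> \<T> w q | w q.
      HNdiv \<Omega> \<Gamma>D w q \<and> Hdiv_eps_norm \<epsilon> \<T> w q \<noteq> 0}"
  proof (rule bdd_aboveI)
    fix r
    assume "r \<in> {(\<Sum>K\<in>\<T>. bdry_pair K w q v g) / Hdiv_eps_norm \<epsilon> \<T> w q | w q.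
      HNdiv \<Omega> \<Gamma>D w q \<and> Hdiv_eps_norm \<epsilon> \<T> w q \<noteq> 0}"
    then obtain w q where r: "r = (\<Sum>K\<in>\<T>. bdry_pair K w q v g) / Hdiv_eps_norm \<epsilon> \<T> w q"
      and w: "HNdiv \<Omega> \<Gamma>D w q" and nz: "Hdiv_eps_norm \<epsilon> \<T> w q \<noteq> 0" by blast
    have L2: "L2_on \<Omega> w" "L2_on \<Omega> q" using w by (auto simp: HNdiv_def weak_div_def)
    define H where "H = Hdiv_eps_norm \<epsilon> \<T> w q"
    have H: "H = sqrt ((L2norm \<Omega> w)\<^sup>2 / \<epsilon> + (L2norm \<Omega> q)\<^sup>2 / \<epsilon>)"
      by (simp add: H_def Hdiv_eps_norm_def bnorm_eq_L2norm[OF tri] L2)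
    have "0 \<le> H" unfolding H using eps by simp
    with nz have "0 < H" by (simp add: H_def)
    \<comment> \<open>Multiplying by \<open>sqrt \<epsilon>\<close> removes the scaling, so the L2
      norms of \<open>w\<close> and \<open>q\<close> are each at most
      \<open>sqrt \<epsilon> * H\<close>. Dividing by \<open>H\<close> then leaves a bound that
      depends on \<open>v\<close> and \<open>g\<close> but not on the field.\<close>
    have "sqrt \<epsilon> * H = sqrt ((L2norm \<Omega> w)\<^sup>2 + (L2norm \<Omega> q)\<^sup>2)"
      unfolding H real_sqrt_mult[symmetric] using eps by (simp add: field_simps)
    then have le: "L2norm \<Omega> w \<le> sqrt \<epsilon> * H" "L2norm \<Omega> q \<le> sqrt \<epsilon> * H"
      by simp_all
    have "(\<Sum>K\<in>\<T>. bdry_pair K w q v g) \<le> L2norm \<Omega> w * L2norm \<Omega> g + L2norm \<Omega> q * L2norm \<Omega> v"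
      using L2_Cauchy_Schwarz[OF L2(1) g] L2_Cauchy_Schwarz[OF L2(2) v]
      by (simp add: sum_bdry_pair[OF tri L2(1) g L2(2) v])
    also have "\<dots> \<le> sqrt \<epsilon> * H * L2norm \<Omega> g + sqrt \<epsilon> * H * L2norm \<Omega> v"
      using le by (intro add_mono mult_right_mono) (auto simp: L2norm_nonneg)
    finally show "r \<le> sqrt \<epsilon> * (L2norm \<Omega> g + L2norm \<Omega> v)"
      unfolding r H_def[symmetric] using \<open>0 < H\<close> by (simp add: field_simps)
  qed
qed (use w nz in blast)

subsection \<open>The broken Poincare inequality\<close>

theorem mainTheorem1:
  fixes \<Omega> \<Gamma>D \<Gamma>N :: "'a::euclidean_space set"
    and \<T> :: "'a set set"
    and \<epsilon> CP :: real
    and v :: "'a \<Rightarrow> real" and g :: "'a \<Rightarrow> 'a"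
  assumes dom: "open \<Omega>" "connected \<Omega>" "bounded \<Omega>"
    and bdry: "\<Gamma>D \<subseteq> frontier \<Omega>" "\<Gamma>N \<subseteq> frontier \<Omega>"
      "openin (top_of_set (frontier \<Omega>)) \<Gamma>D" "openin (top_of_set (frontier \<Omega>)) \<Gamma>N"
      "\<Gamma>D \<inter> \<Gamma>N = {}" "frontier \<Omega> = closure \<Gamma>D \<union> closure \<Gamma>N"
    and GD_pos: "\<Gamma>D \<noteq> {}"
    and eps: "\<epsilon> > 0"
    and tri: "triangulation \<Omega> \<T>"
    and CP_pos: "CP > 0"
    and poincare: "\<And>w h. H1D \<Omega> \<Gamma>D w \<Longrightarrow> weak_grad \<Omega> w h \<Longrightarrow> L2norm \<Omega> w \<le> CP * L2norm \<Omega> h"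
    and v_H1: "\<And>K. K \<in> \<T> \<Longrightarrow> H1 K v"
    and g_grad: "\<And>K. K \<in> \<T> \<Longrightarrow> weak_grad K v g"
  shows "bnorm \<T> v \<le> CP * bnorm \<T> g
           + (1 / sqrt \<epsilon>) * sqrt (1 + CP\<^sup>2) * jump_norm \<epsilon> \<Omega> \<Gamma>D \<T> v g"
proof -
  let ?J = "jump_norm \<epsilon> \<Omega> \<Gamma>D \<T> v g"
  have v: "L2_on \<Omega> v" and g: "L2_on \<Omega> g"
    using v_H1 g_grad by (auto intro!: L2_on_triangulation[OF tri] simp: H1_def weak_grad_def)
  \<comment> \<open>Needed for two right-hand sides: the constant 1, to control the sign of the jump
    norm, and \<open>v\<close>, for the estimate itself.\<close>
  have div_solve: "\<exists>w. HNdiv \<Omega> \<Gamma>D w f \<and> L2norm \<Omega> w \<le> CP * L2norm \<Omega> f" if "L2_on \<Omega> f" for f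
    by (rule HNdiv_exists_div[OF dom(1,3) bdry(1) less_imp_le[OF CP_pos] _ that])
       (blast intro: poincare)+
  note upper = jump_norm_upper[OF tri eps v g]
  have Hdiv: "Hdiv_eps_norm \<epsilon> \<T> w q = sqrt (((L2norm \<Omega> w)\<^sup>2 + (L2norm \<Omega> q)\<^sup>2) / \<epsilon>)"
    if "HNdiv \<Omega> \<Gamma>D w q" for w q
    using that by (auto simp: HNdiv_def weak_div_def Hdiv_eps_norm_def bnorm_eq_L2norm[OF tri] add_divide_distrib)
  have Hdiv_nz: "Hdiv_eps_norm \<epsilon> \<T> w q \<noteq> 0" if "HNdiv \<Omega> \<Gamma>D w q" "L2norm \<Omega> q \<noteq> 0" for w q
    using that(2) eps by (simp add: Hdiv[OF that(1)] sum_power2_eq_zero_iff)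

  \<comment> \<open>A field of divergence \<open>1\<close> and its negative show that the supremum is over a nonempty set and nonnegative.\<close>
  have "\<Omega> \<noteq> {}"
    using GD_pos bdry(1) by auto
  then have "measure lebesgue \<Omega> \<noteq> 0"
    using lmeasurable_open[OF dom(3,1)] open_not_negligible[OF dom(1)] negligible_iff_measure0 by blast
  then have "L2norm \<Omega> (\<lambda>x. 1 :: real) \<noteq> 0"
    using lmeasurable_open[OF dom(3,1)] by (simp add: L2norm_def measure_restrict_space fmeasurable_def)
  moreover obtain w1 where w1: "HNdiv \<Omega> \<Gamma>D w1 (\<lambda>x. 1)"
    using div_solve[OF L2_on_const[OF lmeasurable_open[OF dom(3,1)]]] by blast
  ultimately have nz: "Hdiv_eps_norm \<epsilon> \<T> w1 (\<lambda>x. 1) \<noteq> 0"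
    by (intro Hdiv_nz)
  have "Hdiv_eps_norm \<epsilon> \<T> (\<lambda>x. - w1 x) (\<lambda>x. - 1) = Hdiv_eps_norm \<epsilon> \<T> w1 (\<lambda>x. 1)"
    by (simp add: Hdiv_eps_norm_def bnorm_def)
  moreover have "bdry_pair K (\<lambda>x. - w1 x) (\<lambda>x. - 1) v g = - bdry_pair K w1 (\<lambda>x. 1) v g" for K
    unfolding bdry_pair_def by (subst integral_minus[symmetric]) simp
  ultimately have "- ((\<Sum>K\<in>\<T>. bdry_pair K w1 (\<lambda>x. 1) v g) / Hdiv_eps_norm \<epsilon> \<T> w1 (\<lambda>x. 1)) \<le> ?J"
    using upper[OF HNdiv_uminus[OF w1]] nz by (simp add: sum_negf)
  with upper[OF w1 nz] have J: "0 \<le> ?J" by linarith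

  show ?thesis
  proof (cases "L2norm \<Omega> v = 0")
    \<comment> \<open>Nothing can be divided by \<open>L2norm \<Omega> v\<close> here, but the
      right-hand side is nonnegative by \<open>J\<close>.\<close>
    case True
    then show ?thesis
      using J CP_pos eps by (simp add: bnorm_eq_L2norm[OF tri] v g L2norm_nonneg)
  next
    case False
    then have pos: "0 < L2norm \<Omega> v"
      using L2norm_nonneg[of \<Omega> v] by simp
    obtain w where w: "HNdiv \<Omega> \<Gamma>D w v" and wv: "L2norm \<Omega> w \<le> CP * L2norm \<Omega> v"
      using div_solve[OF v] by blast
    have wL2: "L2_on \<Omega> w" using w by (simp add: HNdiv_def)
    define H where "H = Hdiv_eps_norm \<epsilon> \<T> w v"
    have "0 \<le> H" using eps by (simp add: H_def Hdiv[OF w])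
    then have "0 < H" using Hdiv_nz[OF w False] by (simp add: H_def)
    \<comment> \<open>Origin of \<open>1 + CP\<^sup>2\<close>: the field contributes
      \<open>CP\<^sup>2\<close> and its divergence, which is \<open>v\<close> itself, contributes
      1.\<close>
    have "(L2norm \<Omega> w)\<^sup>2 \<le> (CP * L2norm \<Omega> v)\<^sup>2"
      by (rule power_mono[OF wv L2norm_nonneg])
    then have "H \<le> sqrt ((1 + CP\<^sup>2) * (L2norm \<Omega> v)\<^sup>2 / \<epsilon>)"
      unfolding H_def Hdiv[OF w] using eps
      by (intro real_sqrt_le_mono divide_right_mono) (auto simp: algebra_simps)
    also have "\<dots> = sqrt (1 + CP\<^sup>2) / sqrt \<epsilon> * L2norm \<Omega> v"
      by (simp add: real_sqrt_mult real_sqrt_divide L2norm_nonneg)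
    finally have H_le: "H \<le> sqrt (1 + CP\<^sup>2) / sqrt \<epsilon> * L2norm \<Omega> v" .
    \<comment> \<open>Because the divergence of \<open>w\<close> is \<open>v\<close>, the divergence
      part of the summed pairing is exactly the squared norm to be estimated.\<close>
    have "L2inner \<Omega> w g + (L2norm \<Omega> v)\<^sup>2 \<le> ?J * H"
      using upper[OF w Hdiv_nz[OF w False]] \<open>0 < H\<close>
      by (simp add: H_def[symmetric] sum_bdry_pair[OF tri wL2 g v v] L2norm_power2_eq_L2inner divide_le_eq)
    moreover have "- L2inner \<Omega> w g \<le> CP * L2norm \<Omega> v * L2norm \<Omega> g"
      using L2_Cauchy_Schwarz[OF wL2 g] mult_right_mono[OF wv L2norm_nonneg[of \<Omega> g]] by linarith
    \<comment> \<open>Enlarging \<open>H\<close> to its bound preserves the inequality only because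
      \<open>?J\<close> is nonnegative.\<close>
    moreover have "?J * H \<le> ?J * (sqrt (1 + CP\<^sup>2) / sqrt \<epsilon> * L2norm \<Omega> v)"
      by (rule mult_left_mono[OF H_le J])
    ultimately have "L2norm \<Omega> v * L2norm \<Omega> v
        \<le> (CP * L2norm \<Omega> g + (1 / sqrt \<epsilon>) * sqrt (1 + CP\<^sup>2) * ?J) * L2norm \<Omega> v"
      by (simp add: algebra_simps power2_eq_square)
    then show ?thesis
      using pos by (simp add: bnorm_eq_L2norm[OF tri] v g)
  qed
qed

end
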